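(* Let $P$ be an arbitrary (non-empty) partially ordered set. Let $Y$ be the set of all monotone maps $P\to\{0,1\}$ (with $0<1$), and for $p\in P$ put $\sigma_1(p)=\{y\in Y\mid y(p)=1\}$ and $\sigma_2(p)=\{y\in Y\mid y(p)=0\}$. Let $\mathbf{C}_1$ be the closure on $Y$ with base $\{\sigma_1(p)\mid p\in P\}$ and $\mathbf{C}_2$ the closure on $Y$ with base $\{\sigma_2(p)\mid p\in P\}$. Let $C_1O_2(Y)$ be the collection of all subsets of $Y$ which are simultaneously $\mathbf{C}_1$-closed and $\mathbf{C}_2$-open. Then the ordered set $(P,\le)$ is isomorphic to the collection of proper such subsets ordered by inclusion: $$(P,\le)\;\simeq\;\bigl(C_1O_2(Y)\setminus\{\emptyset,Y\},\ \subseteq\bigr).$$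
   Context: A closure on a set $Y$ is an extensive, monotone, idempotent operator $\mathbf{C}$ on the power set of $Y$; sets $A=\mathbf{C}A$ are called $\mathbf{C}$-closed and their complements in $Y$ are called $\mathbf{C}$-open. The closure with base $K$ (a family of subsets of $Y$) is the closure whose closed sets are exactly the intersections of subfamilies of $K$ (the empty intersection being $Y$). Monotone means order-preserving: $p\le q$ implies $f(p)\le f(q)$. Isomorphism means order isomorphism. *)

theory Defs
  imports Main
begin

definition closure_on :: "'b set \<Rightarrow> ('b set \<Rightarrow> 'b set) \<Rightarrow> bool" where
  "closure_on Y C \<longleftrightarrow>
     (\<forall>A. A \<subseteq> Y \<longrightarrow> C A \<subseteq> Y) \<and>
     (\<forall>A. A \<subseteq> Y \<longrightarrow> A \<subseteq> C A) \<and>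
     (\<forall>A B. A \<subseteq> B \<longrightarrow> B \<subseteq> Y \<longrightarrow> C A \<subseteq> C B) \<and>
     (\<forall>A. A \<subseteq> Y \<longrightarrow> C (C A) = C A)"

definition closed_in :: "'b set \<Rightarrow> ('b set \<Rightarrow> 'b set) \<Rightarrow> 'b set \<Rightarrow> bool" where
  "closed_in Y C A \<longleftrightarrow> A \<subseteq> Y \<and> A = C A"

definition open_in :: "'b set \<Rightarrow> ('b set \<Rightarrow> 'b set) \<Rightarrow> 'b set \<Rightarrow> bool" where
  "open_in Y C A \<longleftrightarrow> A \<subseteq> Y \<and> closed_in Y C (Y - A)"

(* Intersecting with Y makes the empty intersection equal to Y; for L nonempty it has no effect,
   as the members of K are subsets of Y. *)
definition closure_with_base :: "'b set \<Rightarrow> 'b set set \<Rightarrow> ('b set \<Rightarrow> 'b set) \<Rightarrow> bool" where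
  "closure_with_base Y K C \<longleftrightarrow>
     closure_on Y C \<and> {A. closed_in Y C A} = {Y \<inter> \<Inter>L | L. L \<subseteq> K}"

definition closed_open_sets ::
  "'b set \<Rightarrow> ('b set \<Rightarrow> 'b set) \<Rightarrow> ('b set \<Rightarrow> 'b set) \<Rightarrow> 'b set set" where
  "closed_open_sets Y C1 C2 = {A. closed_in Y C1 A \<and> open_in Y C2 A}"

(* The two-element chain {0 < 1} is bool with its library order False < True. *)
definition monotone_maps :: "('p::order \<Rightarrow> bool) set" where
  "monotone_maps = {y. mono y}"

definition sigma1 :: "'p::order \<Rightarrow> ('p \<Rightarrow> bool) set" where
  "sigma1 p = {y \<in> monotone_maps. y p = True}"

definition sigma2 :: "'p::order \<Rightarrow> ('p \<Rightarrow> bool) set" where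
  "sigma2 p = {y \<in> monotone_maps. y p = False}"

definition order_isomorphic_on ::
  "'a set \<Rightarrow> ('a \<Rightarrow> 'a \<Rightarrow> bool) \<Rightarrow> 'b set \<Rightarrow> ('b \<Rightarrow> 'b \<Rightarrow> bool) \<Rightarrow> bool" where
  "order_isomorphic_on A le_A B le_B \<longleftrightarrow>
     (\<exists>f. bij_betw f A B \<and> (\<forall>x\<in>A. \<forall>y\<in>A. le_A x y \<longleftrightarrow> le_B (f x) (f y)))"

text \<open>The closure with a given base exists and is determined on the subsets of \<open>Y\<close>.\<close>

lemma closure_with_base_exists:
  "closure_with_base Y K (\<lambda>A. Y \<inter> \<Inter>{B \<in> K. A \<subseteq> B})"
proof -
  let ?C = "\<lambda>A. Y \<inter> \<Inter>{B \<in> K. A \<subseteq> B}"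
  have ext: "A \<subseteq> ?C A" if "A \<subseteq> Y" for A
    using that by auto
  have mon: "?C A \<subseteq> ?C B" if "A \<subseteq> B" for A B
    using that by auto
  have fixed: "?C (Y \<inter> \<Inter>L) = Y \<inter> \<Inter>L" if "L \<subseteq> K" for L
  proof
    have "L \<subseteq> {B \<in> K. Y \<inter> \<Inter>L \<subseteq> B}"
      using that by auto
    then have "\<Inter>{B \<in> K. Y \<inter> \<Inter>L \<subseteq> B} \<subseteq> \<Inter>L"
      by (rule Inter_anti_mono)
    then show "?C (Y \<inter> \<Inter>L) \<subseteq> Y \<inter> \<Inter>L"
      by auto
    show "Y \<inter> \<Inter>L \<subseteq> ?C (Y \<inter> \<Inter>L)"
      by auto
  qed
  have idem: "?C (?C A) = ?C A" for A
    by (rule fixed) auto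
  have "closure_on Y ?C"
    unfolding closure_on_def using ext mon idem by (intro conjI allI impI) auto
  moreover have "closed_in Y ?C A \<longleftrightarrow> (\<exists>L. A = Y \<inter> \<Inter>L \<and> L \<subseteq> K)" for A
  proof
    assume "closed_in Y ?C A"
    then have "A = Y \<inter> \<Inter>{B \<in> K. A \<subseteq> B}"
      unfolding closed_in_def by (rule conjunct2)
    moreover have "{B \<in> K. A \<subseteq> B} \<subseteq> K"
      by (rule Collect_restrict)
    ultimately show "\<exists>L. A = Y \<inter> \<Inter>L \<and> L \<subseteq> K"
      by (intro exI conjI)
  next
    assume "\<exists>L. A = Y \<inter> \<Inter>L \<and> L \<subseteq> K"
    then obtain L where A: "A = Y \<inter> \<Inter>L" and "L \<subseteq> K"
      by blast
    show "closed_in Y ?C A"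
      unfolding closed_in_def A using fixed[OF \<open>L \<subseteq> K\<close>] by (intro conjI Int_lower1) (rule sym)
  qed
  ultimately show ?thesis
    unfolding closure_with_base_def by (intro conjI Collect_cong)
qed

lemma closure_with_base_unique:
  assumes C: "closure_with_base Y K C" and D: "closure_with_base Y K D" and A: "A \<subseteq> Y"
  shows "C A = D A"
proof -
  have *: "closed_in Y C B \<longleftrightarrow> closed_in Y D B" for B
  proof -
    have "{A. closed_in Y C A} = {A. closed_in Y D A}"
      using C D unfolding closure_with_base_def by simp
    then show ?thesis
      by blast
  qed
  have c: "closure_on Y C" and d: "closure_on Y D"
    using C D unfolding closure_with_base_def by auto
  have le: "E A \<subseteq> F A"
    if E: "closure_on Y E" and F: "closure_on Y F"
      and EF: "\<And>B. closed_in Y F B \<Longrightarrow> closed_in Y E B" for E F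
  proof -
    have FA: "A \<subseteq> F A" "F A \<subseteq> Y" "F (F A) = F A"
      using F A unfolding closure_on_def by simp_all
    then have "closed_in Y F (F A)"
      unfolding closed_in_def by simp
    then have "F A = E (F A)"
      using EF unfolding closed_in_def by blast
    moreover have "E A \<subseteq> E (F A)"
      using E FA unfolding closure_on_def by blast
    ultimately show ?thesis by (rule ssubst)
  qed
  show ?thesis
    by (intro equalityI le c d) (simp_all only: *)
qed

end

theory Submission
  imports Defs
begin

text \<open>
  The isomorphism is \<open>sigma1\<close>. A monotone map \<open>P \<Rightarrow> bool\<close> is an up-set of \<open>P\<close>, and \<open>sigma1 p\<close> is the
  family of up-sets containing \<open>p\<close>; testing it on the principal up-set of \<open>p\<close> shows that \<open>sigma1\<close>
  is an order embedding.

  For surjectivity, a set closed for the first closure is \<open>{y. S \<subseteq> y}\<close> and one open for the second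
  is \<open>{y. y \<inter> T \<noteq> {}}\<close>, for some subsets \<open>S\<close>, \<open>T\<close> of \<open>P\<close>. If both describe the same set \<open>A\<close>, then
  the up-set generated by \<open>S\<close> is a member of \<open>A\<close>, so it meets \<open>T\<close>: there are \<open>p \<in> S\<close> and \<open>q \<in> T\<close>
  with \<open>p \<le> q\<close>. Now \<open>sigma1 q \<subseteq> A \<subseteq> sigma1 p \<subseteq> sigma1 q\<close>, and \<open>A = sigma1 p\<close>. This is
  \<open>Inter_sigma1_eq_Union_sigma1D\<close>. Finally, no \<open>sigma1 p\<close> is trivial, since the constant map \<open>True\<close>
  belongs to it and the constant map \<open>False\<close> does not.
\<close>

text \<open>
  These maps are the test points of the proof: the least up-set containing \<open>S\<close>, used for singletons
  to compare values of \<open>sigma1\<close> and for arbitrary \<open>S\<close> to link a closed set to an open one.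
\<close>

lemma upset_generated_mem_monotone_maps: "(\<lambda>x. \<exists>p\<in>S. p \<le> x) \<in> monotone_maps"
  unfolding monotone_maps_def mono_def by (auto intro: order_trans)

lemma sigma1_subset_iff: "sigma1 p \<subseteq> sigma1 q \<longleftrightarrow> p \<le> q"
proof
  assume "sigma1 p \<subseteq> sigma1 q"
  moreover have "(\<lambda>x. \<exists>p'\<in>{p}. p' \<le> x) \<in> sigma1 p"
    unfolding sigma1_def using upset_generated_mem_monotone_maps[of "{p}"] by simp
  ultimately have "(\<lambda>x. \<exists>p'\<in>{p}. p' \<le> x) \<in> sigma1 q" ..
  then show "p \<le> q"
    by (simp add: sigma1_def)
next
  assume "p \<le> q"
  then show "sigma1 p \<subseteq> sigma1 q"
    by (auto simp: sigma1_def monotone_maps_def dest: monoD)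
qed

lemma inj_sigma1: "inj sigma1"
  by (rule injI) (metis sigma1_subset_iff order_refl order_antisym)

lemma sigma1_subset_monotone_maps: "sigma1 p \<subseteq> monotone_maps"
  by (auto simp: sigma1_def)

lemma monotone_maps_diff_sigma1: "monotone_maps - sigma1 p = sigma2 p"
  by (auto simp: sigma1_def sigma2_def)

lemma sigma1_nontrivial: "sigma1 p \<notin> {{}, monotone_maps}"
proof -
  have "(\<lambda>_. True) \<in> sigma1 p" "(\<lambda>_. False) \<in> monotone_maps - sigma1 p"
    by (auto simp: sigma1_def monotone_maps_def mono_def)
  then show ?thesis
    by blast
qed

text \<open>
  The least member of the intersection must already lie in one of the sets of the union, and this
  single set is then squeezed between \<open>A\<close> and one of the sets being intersected. If \<open>S\<close> is empty, the
  least member is the constant map \<open>False\<close>, which no \<open>sigma1 q\<close> contains, so the hypotheses are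
  contradictory.
\<close>

lemma Inter_sigma1_eq_Union_sigma1D:
  assumes A_Inter: "A = monotone_maps \<inter> (\<Inter>p\<in>S. sigma1 p)"
    and A_Union: "A = (\<Union>q\<in>T. sigma1 q)"
  shows "A \<in> range sigma1"
proof -
  have "(\<lambda>x. \<exists>p\<in>S. p \<le> x) \<in> A"
    unfolding A_Inter sigma1_def using upset_generated_mem_monotone_maps[of S] by auto
  then obtain p q where "p \<in> S" "q \<in> T" "p \<le> q"
    unfolding A_Union sigma1_def by auto
  have "A \<subseteq> sigma1 p"
    using A_Inter \<open>p \<in> S\<close> by blast
  moreover have "sigma1 p \<subseteq> sigma1 q"
    using \<open>p \<le> q\<close> by (simp add: sigma1_subset_iff)
  moreover have "sigma1 q \<subseteq> A"
    using A_Union \<open>q \<in> T\<close> by blast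
  ultimately show ?thesis
    by blast
qed

lemma closed_in_closure_with_base_iff:
  assumes "closure_with_base Y (range s) C"
  shows "closed_in Y C A \<longleftrightarrow> (\<exists>S. A = Y \<inter> (\<Inter>p\<in>S. s p))"
proof -
  have "closed_in Y C A \<longleftrightarrow> A \<in> {Y \<inter> \<Inter>L | L. L \<subseteq> range s}"
    using assms unfolding closure_with_base_def by blast
  also have "\<dots> \<longleftrightarrow> (\<exists>S. A = Y \<inter> (\<Inter>p\<in>S. s p))"
    by (auto simp: subset_image_iff)
  finally show ?thesis .
qed

lemma closed_open_sets_eq_range_sigma1:
  fixes C1 C2 :: "('p::order \<Rightarrow> bool) set \<Rightarrow> ('p \<Rightarrow> bool) set"
  assumes C1: "closure_with_base monotone_maps (range sigma1) C1"
    and C2: "closure_with_base monotone_maps (range sigma2) C2"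
  shows "closed_open_sets monotone_maps C1 C2 = range sigma1"
proof
  show "closed_open_sets monotone_maps C1 C2 \<subseteq> range sigma1"
  proof
    fix A assume "A \<in> closed_open_sets monotone_maps C1 C2"
    then obtain S T where S: "A = monotone_maps \<inter> (\<Inter>p\<in>S. sigma1 p)"
      and T: "monotone_maps - A = monotone_maps \<inter> (\<Inter>q\<in>T. sigma2 q)"
      unfolding closed_open_sets_def open_in_def
        closed_in_closure_with_base_iff[OF C1] closed_in_closure_with_base_iff[OF C2]
      by blast
    \<comment> \<open>Complementation turns the intersection of the \<open>sigma2 q\<close> into a union of the \<open>sigma1 q\<close>.\<close>
    have "A = monotone_maps - (monotone_maps - A)"
      using S by blast
    also have "\<dots> = (\<Union>q\<in>T. sigma1 q)"
      unfolding T using sigma1_subset_monotone_maps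
      by (auto simp flip: monotone_maps_diff_sigma1)
    finally show "A \<in> range sigma1"
      using S by (rule Inter_sigma1_eq_Union_sigma1D[rotated])
  qed
  show "range sigma1 \<subseteq> closed_open_sets monotone_maps C1 C2"
  proof
    fix A :: "('p \<Rightarrow> bool) set" assume "A \<in> range sigma1"
    then obtain p where A: "A = sigma1 p"
      by blast
    \<comment> \<open>A base set and its complement are intersections over the one-element family.\<close>
    have "sigma1 p = monotone_maps \<inter> (\<Inter>p'\<in>{p}. sigma1 p')"
      using sigma1_subset_monotone_maps by blast
    moreover have "monotone_maps - sigma1 p = monotone_maps \<inter> (\<Inter>p'\<in>{p}. sigma2 p')"
      by (auto simp flip: monotone_maps_diff_sigma1)
    ultimately show "A \<in> closed_open_sets monotone_maps C1 C2"
      unfolding A closed_open_sets_def open_in_def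
        closed_in_closure_with_base_iff[OF C1] closed_in_closure_with_base_iff[OF C2]
      using sigma1_subset_monotone_maps by blast
  qed
qed

theorem lemma3:
  fixes C1 C2 :: "('p::order \<Rightarrow> bool) set \<Rightarrow> ('p \<Rightarrow> bool) set"
  assumes "closure_with_base (monotone_maps :: ('p \<Rightarrow> bool) set) (range sigma1) C1"
    and "closure_with_base (monotone_maps :: ('p \<Rightarrow> bool) set) (range sigma2) C2"
  shows "order_isomorphic_on (UNIV :: 'p set) (\<le>)
           (closed_open_sets monotone_maps C1 C2 - {{}, monotone_maps}) (\<subseteq>)"
proof -
  have "closed_open_sets monotone_maps C1 C2 - {{}, monotone_maps} = range sigma1"
    unfolding closed_open_sets_eq_range_sigma1[OF assms] using sigma1_nontrivial by blast
  then have "bij_betw sigma1 UNIV (closed_open_sets monotone_maps C1 C2 - {{}, monotone_maps})"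
    using inj_sigma1 by (simp add: bij_betw_def)
  then show ?thesis
    unfolding order_isomorphic_on_def using sigma1_subset_iff by blast
qed

end
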